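(* Let $X$ be a topometric space. For every ordinal $\alpha$ and every $\varepsilon>0$, $$X^{(\alpha)}_{d,2\varepsilon}\subseteq X^{(\alpha)}_{b,\varepsilon}\subseteq X^{(\alpha)}_{f,\varepsilon}\subseteq X^{(\alpha)}_{d,\varepsilon}.$$ It follows that for all $A\subseteq X$, $$\mathrm{CB}_{d,2\varepsilon}(A)\le \mathrm{CB}_{b,\varepsilon}(A)\le \mathrm{CB}_{f,\varepsilon}(A)\le \mathrm{CB}_{d,\varepsilon}(A).$$ In particular, for $*\in\{d,f,b\}$ the properties of being $*$-CB-analysable are all equivalent.
   Context: A topometric space is a triple $(X,\mathscr{T},d)$ where $\mathscr{T}$ is a topology on $X$ and $d\colon X^2\to[0,\infty]$ is a metric (infinite distances allowed) such that (1) $d$ refines the topology: for every open $U$ and $x\in U$ there is $r>0$ with $\{y: d(x,y)<r\}\subseteq U$; (2) $d$ is lower semi-continuous: for every real $r\ge 0$ the set $\{(a,b): d(a,b)\le r\}$ is closed in $X^2$. Topological terms (open, closed, compact, ...) refer to $\mathscr{T}$. Subsets carry the induced topology and metric, and are then topometric spaces. A set $A\subseteq X$ is $\varepsilon$-$\alpha$-finite ($\alpha\le\omega$) if there is no family $(a_i)_{i\le\alpha}$ in $A$ with $d(a_i,a_j)>\varepsilon$ for all $i<j\le\alpha$. It is $\varepsilon$-finite if it is $\varepsilon$-$n$-finite for some $n<\omega$, and $\varepsilon$-bounded if it is $\varepsilon$-$\omega$-finite. Define $X'_{d,\varepsilon}=X\setminus\bigcup\{U\subseteq X \text{ open}: \mathrm{diam}(U)\le\varepsilon\}$,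 $X'_{f,\varepsilon}=X\setminus\bigcup\{U\subseteq X \text{ open and }\varepsilon\text{-finite}\}$, $X'_{b,\varepsilon}=X\setminus\bigcup\{U\subseteq X \text{ open and }\varepsilon\text{-bounded}\}$. For $*\in\{d,f,b\}$ put $X^{(0)}_{*,\varepsilon}=X$, $X^{(\alpha+1)}_{*,\varepsilon}=(X^{(\alpha)}_{*,\varepsilon})'_{*,\varepsilon}$ (computed in the subspace $X^{(\alpha)}_{*,\varepsilon}$), $X^{(\alpha)}_{*,\varepsilon}=\bigcap_{\beta<\alpha}X^{(\beta)}_{*,\varepsilon}$ for limit $\alpha$, and $X^{(\infty)}_{*,\varepsilon}=\bigcap_\alpha X^{(\alpha)}_{*,\varepsilon}$. For $A\subseteq X$, $\mathrm{CB}_{*,\varepsilon}(A)=\sup\{\alpha: X^{(\alpha)}_{*,\varepsilon}\cap A\ne\varnothing\}$ (equal to $\infty$ if this holds for all ordinals $\alpha$). $X$ is $( *,\varepsilon)$-CB-analysable if $X^{(\infty)}_{*,\varepsilon}=\varnothing$, and $*$-CB-analysable if it is $( *,\varepsilon)$-CB-analysable for all $\varepsilon>0$. *)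

theory Defs
  imports "HOL-Analysis.Analysis" "HOL-Library.Extended_Nat" "HOL-Library.Extended"
begin

no_notation Pinf (\<open>\<infinity>\<close>)

(* Topological notions refer to T, metric notions to d.  The carrier X is topspace T; the values
   of d outside X are irrelevant. *)
locale topometric_space =
  fixes T :: "'a topology" and d :: "'a \<Rightarrow> 'a \<Rightarrow> ennreal"
  assumes dist_zero: "\<lbrakk>x \<in> topspace T; y \<in> topspace T\<rbrakk> \<Longrightarrow> d x y = 0 \<longleftrightarrow> x = y"
    and dist_sym: "\<lbrakk>x \<in> topspace T; y \<in> topspace T\<rbrakk> \<Longrightarrow> d x y = d y x"
    and dist_triangle: "\<lbrakk>x \<in> topspace T; y \<in> topspace T; z \<in> topspace T\<rbrakk> \<Longrightarrow> d x z \<le> d x y + d y z"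
    and refines: "\<lbrakk>openin T U; x \<in> U\<rbrakk> \<Longrightarrow> \<exists>r::real>0. {y \<in> topspace T. d x y < ennreal r} \<subseteq> U"
    and lower_semicontinuous:
      "0 \<le> r \<Longrightarrow> closedin (prod_topology T T)
         {(a, b). a \<in> topspace T \<and> b \<in> topspace T \<and> d a b \<le> ennreal r}"

definition diam :: "('a \<Rightarrow> 'a \<Rightarrow> ennreal) \<Rightarrow> 'a set \<Rightarrow> ennreal" where
  "diam d A = (SUP x\<in>A. SUP y\<in>A. d x y)"

(* Here alpha \<le> \<omega> is encoded as an extended natural number: the index set
   {i. i \<le> alpha} has order type alpha + 1 (so \<omega> + 1 if alpha = \<infinity>). *)
definition eps_alpha_finite :: "('a \<Rightarrow> 'a \<Rightarrow> ennreal) \<Rightarrow> real \<Rightarrow> enat \<Rightarrow> 'a set \<Rightarrow> bool" where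
  "eps_alpha_finite d \<epsilon> \<alpha> A \<longleftrightarrow>
     \<not> (\<exists>a :: enat \<Rightarrow> 'a. (\<forall>i\<le>\<alpha>. a i \<in> A) \<and> (\<forall>i j. i < j \<and> j \<le> \<alpha> \<longrightarrow> d (a i) (a j) > ennreal \<epsilon>))"

definition eps_finite :: "('a \<Rightarrow> 'a \<Rightarrow> ennreal) \<Rightarrow> real \<Rightarrow> 'a set \<Rightarrow> bool" where
  "eps_finite d \<epsilon> A \<longleftrightarrow> (\<exists>n::nat. eps_alpha_finite d \<epsilon> (enat n) A)"

definition eps_bounded :: "('a \<Rightarrow> 'a \<Rightarrow> ennreal) \<Rightarrow> real \<Rightarrow> 'a set \<Rightarrow> bool" where
  "eps_bounded d \<epsilon> A \<longleftrightarrow> eps_alpha_finite d \<epsilon> \<infinity> A"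

datatype cb_kind = CB_d | CB_f | CB_b

fun cb_small :: "cb_kind \<Rightarrow> ('a \<Rightarrow> 'a \<Rightarrow> ennreal) \<Rightarrow> real \<Rightarrow> 'a set \<Rightarrow> bool" where
  "cb_small CB_d d \<epsilon> U \<longleftrightarrow> diam d U \<le> ennreal \<epsilon>"
| "cb_small CB_f d \<epsilon> U \<longleftrightarrow> eps_finite d \<epsilon> U"
| "cb_small CB_b d \<epsilon> U \<longleftrightarrow> eps_bounded d \<epsilon> U"

definition cb_derivative :: "cb_kind \<Rightarrow> 'a topology \<Rightarrow> ('a \<Rightarrow> 'a \<Rightarrow> ennreal) \<Rightarrow> real \<Rightarrow> 'a set" where
  "cb_derivative k T d \<epsilon> = topspace T - \<Union>{U. openin T U \<and> cb_small k d \<epsilon> U}"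

(* An ordinal is an element alpha of an arbitrary well-ordered type 'o; it stands for the order
   type of {..<alpha}.  The three branches are: alpha = 0, alpha a successor (with predecessor
   the greatest element below alpha), alpha a limit. *)
function cb_iter ::
  "cb_kind \<Rightarrow> 'a topology \<Rightarrow> ('a \<Rightarrow> 'a \<Rightarrow> ennreal) \<Rightarrow> real \<Rightarrow> 'o::wellorder \<Rightarrow> 'a set" where
  "cb_iter k T d \<epsilon> \<alpha> =
     (if \<forall>\<beta>. \<not> \<beta> < \<alpha> then topspace T
      else if \<exists>\<beta><\<alpha>. \<forall>\<gamma><\<alpha>. \<gamma> \<le> \<beta>
        then cb_derivative k (subtopology T (cb_iter k T d \<epsilon> (GREATEST \<beta>. \<beta> < \<alpha>))) d \<epsilon>
      else (\<Inter>\<beta>\<in>{..<\<alpha>}. cb_iter k T d \<epsilon> \<beta>))"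
  by pat_completeness auto
termination
proof (relation "inv_image {(x, y). x < y} (\<lambda>(_, _, _, _, \<alpha>). \<alpha>)")
  show "wf (inv_image {(x, y). x < y} (\<lambda>(_::cb_kind, _::'a topology, _::'a \<Rightarrow> 'a \<Rightarrow> ennreal, _::real, \<alpha>::'o::wellorder). \<alpha>))"
    by (intro wf_inv_image wf)
next
  fix k :: cb_kind and T :: "'a topology" and d :: "'a \<Rightarrow> 'a \<Rightarrow> ennreal" and \<epsilon> :: real and \<alpha> :: "'o::wellorder"
  assume "\<exists>\<beta><\<alpha>. \<forall>\<gamma><\<alpha>. \<gamma> \<le> \<beta>"
  then obtain \<beta> where "\<beta> < \<alpha>" "\<forall>\<gamma><\<alpha>. \<gamma> \<le> \<beta>" by blast
  then have "(GREATEST \<beta>. \<beta> < \<alpha>) = \<beta>" by (intro Greatest_equality) auto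
  with \<open>\<beta> < \<alpha>\<close>
  show "((k, T, d, \<epsilon>, GREATEST \<beta>. \<beta> < \<alpha>), (k, T, d, \<epsilon>, \<alpha>))
        \<in> inv_image {(x, y). x < y} (\<lambda>(_, _, _, _, \<alpha>). \<alpha>)" by simp
qed auto

declare cb_iter.simps [simp del]

(* A sufficiently long initial segment of the ordinals for spaces whose points have type 'a: the
   ordinals below the least ordinal of cardinality 2^(2^|'a|).  By the lemma cb_iter_stationary
   below, the iteration is already constant from some element of this type on, so quantifying
   over this type amounts to quantifying over all ordinals. *)
typedef 'a ordinal = "UNIV :: 'a set set set" by simp

instantiation ordinal :: (type) ord
begin

definition less_eq_ordinal :: "'a ordinal \<Rightarrow> 'a ordinal \<Rightarrow> bool" where
  "\<alpha> \<le> \<beta> \<longleftrightarrow> (Rep_ordinal \<alpha>, Rep_ordinal \<beta>) \<in> card_of (UNIV :: 'a set set set)"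

definition less_ordinal :: "'a ordinal \<Rightarrow> 'a ordinal \<Rightarrow> bool" where
  "(\<alpha> :: 'a ordinal) < \<beta> \<longleftrightarrow> \<alpha> \<le> \<beta> \<and> \<alpha> \<noteq> \<beta>"

instance ..

end

lemma card_of_UNIV_facts:
  shows "refl (card_of (UNIV :: 'a set set set))"
    and "trans (card_of (UNIV :: 'a set set set))"
    and "antisym (card_of (UNIV :: 'a set set set))"
    and "total (card_of (UNIV :: 'a set set set))"
    and "wf ((card_of (UNIV :: 'a set set set)) - Id)"
  using card_of_well_order_on[of "UNIV :: 'a set set set"]
  by (simp_all add: well_order_on_def linear_order_on_def partial_order_on_def preorder_on_def)

lemma wf_ordinal: "wf {(x::'a ordinal, y). x < y}"
  by (rule wf_subset[OF wf_inv_image[OF card_of_UNIV_facts(5), of Rep_ordinal]])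
    (auto simp: less_ordinal_def less_eq_ordinal_def inv_image_def Rep_ordinal_inject)

lemma ordinal_antisym: "x = y" if "x \<le> y" "y \<le> x" for x y :: "'a ordinal"
  using antisymD[OF card_of_UNIV_facts(3), of "Rep_ordinal x" "Rep_ordinal y"] that
  by (simp add: less_eq_ordinal_def Rep_ordinal_inject)

lemma ordinal_refl: "x \<le> x" for x :: "'a ordinal"
  using card_of_UNIV_facts(1)[where 'a = 'a] by (simp add: less_eq_ordinal_def refl_on_def)

lemma ordinal_less_le_not_le: "x < y \<longleftrightarrow> x \<le> y \<and> \<not> y \<le> x" for x y :: "'a ordinal"
proof (cases "x = y")
  case False
  then have "\<not> (x \<le> y \<and> y \<le> x)" using ordinal_antisym[of x y] by argo
  then show ?thesis using False unfolding less_ordinal_def by argo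
qed (simp add: less_ordinal_def)

lemma ordinal_trans: "x \<le> y \<Longrightarrow> y \<le> z \<Longrightarrow> x \<le> z" for x y z :: "'a ordinal"
  unfolding less_eq_ordinal_def by (rule transD[OF card_of_UNIV_facts(2)])

lemma ordinal_linear: "x \<le> y \<or> y \<le> x" for x y :: "'a ordinal"
  using ordinal_refl[of x] card_of_UNIV_facts(4)[where 'a = 'a] unfolding less_eq_ordinal_def total_on_def
  by (metis Rep_ordinal_inject UNIV_I)

instance ordinal :: (type) wellorder
proof
    fix P :: "'a ordinal \<Rightarrow> bool" and a :: "'a ordinal"
    assume step: "\<And>x. (\<And>y. y < x \<Longrightarrow> P y) \<Longrightarrow> P x"
    show "P a"
    proof (rule wf_induct[OF wf_ordinal, of P])
      fix x assume "\<forall>y. (y, x) \<in> {(x::'a ordinal, y). x < y} \<longrightarrow> P y"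
      then have "P y" if "y < x" for y using that by simp
      then show "P x" by (rule step)
    qed
next
  fix x y z :: "'a ordinal"
  show "(x < y) = (x \<le> y \<and> \<not> y \<le> x)" by (rule ordinal_less_le_not_le)
  show "x \<le> x" by (rule ordinal_refl)
  show "x \<le> z" if "x \<le> y" "y \<le> z" using that by (rule ordinal_trans)
  show "x = y" if "x \<le> y" "y \<le> x" using that by (rule ordinal_antisym)
  show "x \<le> y \<or> y \<le> x" by (rule ordinal_linear)
qed

lemma eps_alpha_finite_mono: "eps_alpha_finite d \<epsilon> \<alpha> U \<Longrightarrow> V \<subseteq> U \<Longrightarrow> eps_alpha_finite d \<epsilon> \<alpha> V"
  unfolding eps_alpha_finite_def
proof (elim contrapos_nn exE conjE)
  fix a :: "enat \<Rightarrow> 'a"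
  assume "V \<subseteq> U" and a: "\<forall>i\<le>\<alpha>. a i \<in> V"
    and sep: "\<forall>i j. i < j \<and> j \<le> \<alpha> \<longrightarrow> d (a i) (a j) > ennreal \<epsilon>"
  then have "\<forall>i\<le>\<alpha>. a i \<in> U" by blast
  with sep show "\<exists>a. (\<forall>i\<le>\<alpha>. a i \<in> U) \<and> (\<forall>i j. i < j \<and> j \<le> \<alpha> \<longrightarrow> d (a i) (a j) > ennreal \<epsilon>)"
    by (intro exI[of _ a] conjI)
qed

lemma cb_small_mono: "cb_small k d \<epsilon> U \<Longrightarrow> V \<subseteq> U \<Longrightarrow> cb_small k d \<epsilon> V"
proof (cases k)
  case CB_d
  assume "cb_small k d \<epsilon> U" "V \<subseteq> U"
  moreover from \<open>V \<subseteq> U\<close> have "diam d V \<le> diam d U"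
    unfolding diam_def by (intro SUP_subset_mono) auto
  ultimately show ?thesis using CB_d by simp
next
  case CB_f
  assume "cb_small k d \<epsilon> U" "V \<subseteq> U"
  then show ?thesis using CB_f by (auto simp: eps_finite_def intro: eps_alpha_finite_mono)
next
  case CB_b
  assume "cb_small k d \<epsilon> U" "V \<subseteq> U"
  then show ?thesis using CB_b by (auto simp: eps_bounded_def intro: eps_alpha_finite_mono)
qed

lemma cb_derivative_mono:
  assumes "F \<subseteq> S"
  shows "cb_derivative k (subtopology T F) d \<epsilon> \<subseteq> cb_derivative k (subtopology T S) d \<epsilon>"
proof
  fix x assume x: "x \<in> cb_derivative k (subtopology T F) d \<epsilon>"
  have "x \<notin> U" if "openin (subtopology T S) U" "cb_small k d \<epsilon> U" for U
  proof
    assume "x \<in> U"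
    obtain W where W: "openin T W" "U = W \<inter> S" using \<open>openin (subtopology T S) U\<close>
      by (auto simp: openin_subtopology)
    have "openin (subtopology T F) (W \<inter> F)" using W(1) by (auto simp: openin_subtopology)
    moreover have "cb_small k d \<epsilon> (W \<inter> F)"
      using cb_small_mono[OF that(2)] W(2) assms by blast
    ultimately show False
      using x \<open>x \<in> U\<close> W(2) unfolding cb_derivative_def by auto
  qed
  then show "x \<in> cb_derivative k (subtopology T S) d \<epsilon>"
    using x assms unfolding cb_derivative_def by auto
qed

lemma cb_iter_zero: "(\<And>\<beta>. \<not> \<beta> < \<alpha>) \<Longrightarrow> cb_iter k T d \<epsilon> \<alpha> = topspace T"
  by (subst cb_iter.simps) auto

lemma cb_iter_succ:
  assumes "\<beta> < \<alpha>" "\<And>\<gamma>. \<gamma> < \<alpha> \<Longrightarrow> \<gamma> \<le> \<beta>"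
  shows "cb_iter k T d \<epsilon> \<alpha> = cb_derivative k (subtopology T (cb_iter k T d \<epsilon> \<beta>)) d \<epsilon>"
proof -
  have "(GREATEST \<beta>. \<beta> < \<alpha>) = \<beta>" using assms by (intro Greatest_equality) auto
  moreover have "\<not> (\<forall>\<beta>. \<not> \<beta> < \<alpha>)" "\<exists>\<beta><\<alpha>. \<forall>\<gamma><\<alpha>. \<gamma> \<le> \<beta>" using assms by blast+
  ultimately show ?thesis by (subst cb_iter.simps) (simp only: if_False if_True)
qed

lemma cb_iter_limit:
  assumes "\<beta> < \<alpha>" "\<And>\<beta>. \<beta> < \<alpha> \<Longrightarrow> \<exists>\<gamma><\<alpha>. \<beta> < \<gamma>"
  shows "cb_iter k T d \<epsilon> \<alpha> = (\<Inter>\<beta>\<in>{..<\<alpha>}. cb_iter k T d \<epsilon> \<beta>)"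
proof -
  have "\<not> (\<exists>\<beta><\<alpha>. \<forall>\<gamma><\<alpha>. \<gamma> \<le> \<beta>)"
  proof
    assume "\<exists>\<beta><\<alpha>. \<forall>\<gamma><\<alpha>. \<gamma> \<le> \<beta>"
    then obtain \<beta> where "\<beta> < \<alpha>" and max: "\<forall>\<gamma><\<alpha>. \<gamma> \<le> \<beta>" by blast
    from assms(2)[OF this(1)] obtain \<gamma> where "\<gamma> < \<alpha>" "\<beta> < \<gamma>" by blast
    with max show False by (simp add: leD)
  qed
  moreover have "\<not> (\<forall>\<beta>. \<not> \<beta> < \<alpha>)" using assms(1) by blast
  ultimately show ?thesis by (subst cb_iter.simps) (simp only: if_False)
qed

lemma cb_iter_cases:
  fixes \<alpha> :: "'o::wellorder"
  obtains (zero) "\<And>\<beta>. \<not> \<beta> < \<alpha>"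
  | (succ) \<beta> where "\<beta> < \<alpha>" "\<And>\<gamma>. \<gamma> < \<alpha> \<Longrightarrow> \<gamma> \<le> \<beta>"
  | (limit) \<beta> where "\<beta> < \<alpha>" "\<And>\<beta>. \<beta> < \<alpha> \<Longrightarrow> \<exists>\<gamma><\<alpha>. \<beta> < \<gamma>"
proof (cases "\<exists>\<beta><\<alpha>. \<forall>\<gamma><\<alpha>. \<gamma> \<le> \<beta>")
  case True
  then obtain \<beta> where "\<beta> < \<alpha>" "\<forall>\<gamma><\<alpha>. \<gamma> \<le> \<beta>" by blast
  then have "\<beta> < \<alpha>" "\<gamma> < \<alpha> \<Longrightarrow> \<gamma> \<le> \<beta>" for \<gamma> by blast+
  then show ?thesis by (rule succ)
next
  case no_max: False
  show ?thesis
  proof (cases "\<exists>\<beta>. \<beta> < \<alpha>")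
    case True
    then obtain \<beta> where "\<beta> < \<alpha>" by blast
    then show ?thesis
    proof (rule limit)
      fix \<delta> assume "\<delta> < \<alpha>"
      with no_max have "\<not> (\<forall>\<gamma><\<alpha>. \<gamma> \<le> \<delta>)" by blast
      then show "\<exists>\<gamma><\<alpha>. \<delta> < \<gamma>" by (simp add: not_le)
    qed
  next
    case False
    then have "\<not> \<beta> < \<alpha>" for \<beta> by blast
    then show ?thesis by (rule zero)
  qed
qed

lemma cb_iter_antimono:
  fixes \<alpha> :: "'o::wellorder"
  shows "\<beta> \<le> \<alpha> \<Longrightarrow> cb_iter k T d \<epsilon> \<alpha> \<subseteq> cb_iter k T d \<epsilon> \<beta>"
proof (induction \<alpha> arbitrary: \<beta> rule: less_induct)
  case (less \<alpha>)
  show ?case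
  proof (cases "\<beta> = \<alpha>")
    case False
    with less.prems have "\<beta> < \<alpha>" by simp
    show ?thesis
    proof (cases \<alpha> rule: cb_iter_cases)
      case zero
      with \<open>\<beta> < \<alpha>\<close> show ?thesis by blast
    next
      case (succ \<gamma>)
      have "cb_iter k T d \<epsilon> \<alpha> = cb_derivative k (subtopology T (cb_iter k T d \<epsilon> \<gamma>)) d \<epsilon>"
        using succ by (rule cb_iter_succ)
      also have "\<dots> \<subseteq> cb_iter k T d \<epsilon> \<gamma>"
        by (auto simp: cb_derivative_def)
      also have "\<dots> \<subseteq> cb_iter k T d \<epsilon> \<beta>"
        using \<open>\<beta> < \<alpha>\<close> succ by (intro less.IH)
      finally show ?thesis .
    next
      case (limit \<gamma>)
      have "cb_iter k T d \<epsilon> \<alpha> = (\<Inter>\<beta>\<in>{..<\<alpha>}. cb_iter k T d \<epsilon> \<beta>)"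
        using limit by (rule cb_iter_limit)
      with \<open>\<beta> < \<alpha>\<close> show ?thesis by auto
    qed
  qed simp
qed

lemma fixed_subset_cb_iter:
  fixes \<gamma> :: "'o::wellorder"
  assumes F: "F \<subseteq> cb_derivative k (subtopology T F) d \<epsilon>"
  shows "F \<subseteq> cb_iter k T d \<epsilon> \<gamma>"
proof (induction \<gamma> rule: less_induct)
  case (less \<gamma>)
  show ?case
  proof (cases \<gamma> rule: cb_iter_cases)
    case zero
    then have "cb_iter k T d \<epsilon> \<gamma> = topspace T" by (rule cb_iter_zero)
    then show ?thesis using F by (auto simp: cb_derivative_def)
  next
    case (succ \<delta>)
    have "F \<subseteq> cb_iter k T d \<epsilon> \<delta>" using succ(1) by (rule less.IH)
    note F
    also have "cb_derivative k (subtopology T F) d \<epsilon>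
        \<subseteq> cb_derivative k (subtopology T (cb_iter k T d \<epsilon> \<delta>)) d \<epsilon>"
      using \<open>F \<subseteq> cb_iter k T d \<epsilon> \<delta>\<close> by (rule cb_derivative_mono)
    also have "\<dots> = cb_iter k T d \<epsilon> \<gamma>" using succ by (rule cb_iter_succ[symmetric])
    finally show ?thesis .
  next
    case (limit \<delta>)
    have "cb_iter k T d \<epsilon> \<gamma> = (\<Inter>\<beta>\<in>{..<\<gamma>}. cb_iter k T d \<epsilon> \<beta>)"
      using limit by (rule cb_iter_limit)
    then show ?thesis using less.IH by auto
  qed
qed

lemma not_inj_ordinal: "\<not> inj (f :: 'a ordinal \<Rightarrow> 'a set)"
proof
  assume "inj f"
  moreover have "inj (Abs_ordinal :: 'a set set \<Rightarrow> 'a ordinal)"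
    by (auto simp: inj_def Abs_ordinal_inject)
  ultimately have "inj (f \<circ> Abs_ordinal)"
    by (rule inj_compose)
  then have "surj (inv (f \<circ> Abs_ordinal))"
    by (rule inj_imp_surj_inv)
  then show False
    using Cantors_theorem[of "UNIV :: 'a set set"] unfolding Pow_UNIV by blast
qed

lemma cb_iter_stationary:
  "\<exists>\<alpha> :: 'a ordinal. \<forall>\<beta> :: 'o::wellorder.
     cb_iter k T d \<epsilon> \<alpha> \<subseteq> (cb_iter k T d \<epsilon> \<beta> :: 'a set)"
proof -
  let ?I = "cb_iter k T d \<epsilon> :: 'a ordinal \<Rightarrow> 'a set"
  obtain \<alpha> \<beta> where "\<alpha> \<noteq> \<beta>" "?I \<alpha> = ?I \<beta>"
    using not_inj_ordinal[of ?I] unfolding inj_def by blast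
  then obtain \<alpha> \<beta> where "\<alpha> < \<beta>" and eq: "?I \<alpha> = ?I \<beta>"
    by (cases \<alpha> \<beta> rule: linorder_cases) auto
  define \<sigma> where "\<sigma> = (LEAST \<sigma>. \<alpha> < \<sigma>)"
  have "\<alpha> < \<sigma>" unfolding \<sigma>_def using \<open>\<alpha> < \<beta>\<close> by (rule LeastI)
  have "\<sigma> \<le> \<beta>" unfolding \<sigma>_def using \<open>\<alpha> < \<beta>\<close> by (rule Least_le)
  have "\<gamma> \<le> \<alpha>" if "\<gamma> < \<sigma>" for \<gamma>
    using not_less_Least[OF that[unfolded \<sigma>_def]] by simp
  with \<open>\<alpha> < \<sigma>\<close> have "?I \<sigma> = cb_derivative k (subtopology T (?I \<alpha>)) d \<epsilon>"
    by (rule cb_iter_succ)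
  moreover have "?I \<beta> \<subseteq> ?I \<sigma>" using \<open>\<sigma> \<le> \<beta>\<close> by (rule cb_iter_antimono)
  ultimately have "?I \<alpha> \<subseteq> cb_derivative k (subtopology T (?I \<alpha>)) d \<epsilon>" using eq by simp
  then have "?I \<alpha> \<subseteq> cb_iter k T d \<epsilon> \<beta>" for \<beta> :: 'o
    by (rule fixed_subset_cb_iter)
  then show ?thesis by (intro exI[of _ \<alpha>] allI)
qed

definition cb_infinity :: "cb_kind \<Rightarrow> 'a topology \<Rightarrow> ('a \<Rightarrow> 'a \<Rightarrow> ennreal) \<Rightarrow> real \<Rightarrow> 'a set" where
  "cb_infinity k T d \<epsilon> = (\<Inter>\<alpha> :: 'a ordinal. cb_iter k T d \<epsilon> \<alpha>)"

(* The supremum is spelled out as a least upper bound, Pinf being the value if all ordinals occur.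
   Otherwise the set {alpha. cb_iter k T d eps alpha meets A} omits some alpha and, the iteration
   being decreasing, is bounded by it, so the least upper bound exists in 'a ordinal. *)
definition cb_rank ::
  "cb_kind \<Rightarrow> 'a topology \<Rightarrow> ('a \<Rightarrow> 'a \<Rightarrow> ennreal) \<Rightarrow> real \<Rightarrow> 'a set \<Rightarrow> 'a ordinal extended" where
  "cb_rank k T d \<epsilon> A =
     (if \<forall>\<alpha> :: 'a ordinal. cb_iter k T d \<epsilon> \<alpha> \<inter> A \<noteq> {} then Pinf
      else Fin (LEAST \<beta>. \<forall>\<alpha>. cb_iter k T d \<epsilon> \<alpha> \<inter> A \<noteq> {} \<longrightarrow> \<alpha> \<le> \<beta>))"

definition eps_cb_analysable ::
  "cb_kind \<Rightarrow> 'a topology \<Rightarrow> ('a \<Rightarrow> 'a \<Rightarrow> ennreal) \<Rightarrow> real \<Rightarrow> bool" where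
  "eps_cb_analysable k T d \<epsilon> \<longleftrightarrow> cb_infinity k T d \<epsilon> = {}"

definition cb_analysable :: "cb_kind \<Rightarrow> 'a topology \<Rightarrow> ('a \<Rightarrow> 'a \<Rightarrow> ennreal) \<Rightarrow> bool" where
  "cb_analysable k T d \<longleftrightarrow> (\<forall>\<epsilon>>0. eps_cb_analysable k T d \<epsilon>)"

end

theory Submission
  imports Defs
begin

text \<open>The derivatives are monotone in the space, and intersections preserve inclusions, so by
  transfinite induction (lemma \<open>cb_iter_subset\<close>) it suffices to compare the three derivatives of a single topometric space: a
  subspace of a topometric space is again one.

  Two comparisons are purely metric: a set of diameter at most \<open>\<epsilon>\<close> contains no two
  points at distance more than \<open>\<epsilon>\<close>, hence is \<open>\<epsilon>\<close>-finite, and an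
  \<open>\<epsilon>\<close>-finite set is \<open>\<epsilon>\<close>-bounded because an infinite separated
  sequence has finite initial segments of every length.

  The remaining one, lemma \<open>diam_nhd_in_bounded_open\<close>, is local and is where topology meets
  metric. Suppose that no neighbourhood of a point \<open>x\<close> of an open set \<open>U\<close> has diameter
  at most \<open>2\<epsilon>\<close>. By the triangle inequality, every neighbourhood of \<open>x\<close>
  contains a point at distance more than \<open>\<epsilon>\<close> from \<open>x\<close>. By lower
  semi-continuity, being at distance more than \<open>\<epsilon>\<close> from a fixed point is an open
  condition, so after choosing such a point one can shrink the neighbourhood of \<open>x\<close> to
  stay far from it. Repeating this gives a sequence in \<open>U\<close> that is separated by more than
  \<open>\<epsilon>\<close>; putting \<open>x\<close> itself at position \<open>\<omega>\<close> shows that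
  \<open>U\<close> is not \<open>\<epsilon>\<close>-bounded. The loss of the factor 2 disappears in
  analysability, which quantifies over all \<open>\<epsilon>\<close>.\<close>

lemma topometric_subspace:
  assumes "topometric_space T d"
  shows "topometric_space (subtopology T S) d"
proof -
  interpret topometric_space T d by fact
  show ?thesis
  proof
    fix U x assume "openin (subtopology T S) U" "x \<in> U"
    then obtain W where W: "openin T W" "U = W \<inter> S" by (auto simp: openin_subtopology)
    with \<open>x \<in> U\<close> obtain r :: real
      where "r > 0" "{y \<in> topspace T. d x y < ennreal r} \<subseteq> W"
      using refines[OF W(1), of x] by blast
    then show "\<exists>r::real>0. {y \<in> topspace (subtopology T S). d x y < ennreal r} \<subseteq> U"
      using W by (intro exI[of _ r]) auto
  next
    fix r :: real assume "0 \<le> r"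
    define C where
      "C = {(a, b). a \<in> topspace T \<and> b \<in> topspace T \<and> d a b \<le> ennreal r}"
    have "closedin (prod_topology T T) C"
      unfolding C_def using \<open>0 \<le> r\<close> by (rule lower_semicontinuous)
    then have "closedin (subtopology (prod_topology T T) (S \<times> S)) (C \<inter> S \<times> S)"
      by (auto simp: closedin_subtopology)
    moreover have "C \<inter> S \<times> S = {(a, b). a \<in> topspace (subtopology T S)
        \<and> b \<in> topspace (subtopology T S) \<and> d a b \<le> ennreal r}"
      unfolding C_def by auto
    ultimately show "closedin (prod_topology (subtopology T S) (subtopology T S))
        {(a, b). a \<in> topspace (subtopology T S) \<and> b \<in> topspace (subtopology T S)
          \<and> d a b \<le> ennreal r}"
      by (simp add: subtopology_Times)
  qed (auto simp: dist_zero intro: dist_sym dist_triangle)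
qed

context topometric_space
begin

lemma openin_far:
  assumes "a \<in> topspace T" "0 \<le> r"
  shows "openin T {y \<in> topspace T. d a y > ennreal r}"
proof -
  have "continuous_map T (prod_topology T T) (\<lambda>y. (a, y))"
    using assms by (simp add: continuous_map_pairwise o_def)
  from closedin_continuous_map_preimage[OF this lower_semicontinuous[OF assms(2)]]
  have "openin T (topspace T - {y \<in> topspace T. d a y \<le> ennreal r})"
    using assms(1) by (intro openin_diff) auto
  also have "topspace T - {y \<in> topspace T. d a y \<le> ennreal r}
      = {y \<in> topspace T. d a y > ennreal r}"
    by auto
  finally show ?thesis .
qed

text \<open>Of two points at distance more than \<open>2\<epsilon>\<close>, at least one is farther than
  \<open>\<epsilon>\<close> from \<open>x\<close>.\<close>

lemma far_point_of_large_diam: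
  assumes "V \<subseteq> topspace T" "x \<in> topspace T" "0 \<le> \<epsilon>" "\<not> diam d V \<le> ennreal (2 * \<epsilon>)"
  obtains y where "y \<in> V" "d y x > ennreal \<epsilon>"
proof -
  from assms(4) obtain y z where yz: "y \<in> V" "z \<in> V" "\<not> d y z \<le> ennreal (2 * \<epsilon>)"
    unfolding diam_def by (auto simp: SUP_le_iff)
  have "d y x > ennreal \<epsilon> \<or> d z x > ennreal \<epsilon>"
  proof (rule ccontr)
    assume "\<not> ?thesis"
    then have "d y x + d x z \<le> ennreal \<epsilon> + ennreal \<epsilon>"
      using yz assms dist_sym[of x z] by (intro add_mono) auto
    also have "\<dots> = ennreal (2 * \<epsilon>)"
      using \<open>0 \<le> \<epsilon>\<close> by (simp flip: ennreal_plus)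
    finally show False
      using yz assms dist_triangle[of y x z] by (meson order_trans subsetD)
  qed
  then show ?thesis using yz that by blast
qed

text \<open>If the conclusion fails, a separated sequence indexed by \<open>\<omega> + 1\<close> with \<open>x\<close> in
  the last place can be built by recursion. The recursion carries a pair of a chosen point and a
  neighbourhood of \<open>x\<close> all of whose points are far from it. Since each neighbourhood lies
  in the preceding one and supplies the next point, every point is far from all later points, not
  only from the next one, and from \<open>x\<close>.\<close>

lemma diam_nhd_in_bounded_open:
  assumes U: "openin T U" "eps_bounded d \<epsilon> U" and x: "x \<in> U" and "0 \<le> \<epsilon>"
  obtains V where "openin T V" "x \<in> V" "diam d V \<le> ennreal (2 * \<epsilon>)"
proof (rule ccontr)
  assume "\<not> thesis"
  with that have large: "\<not> diam d V \<le> ennreal (2 * \<epsilon>)" if "openin T V" "x \<in> V" for V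
    using that by blast
  define good where "good = (\<lambda>(a, V). a \<in> U \<and> openin T V \<and> x \<in> V \<and> V \<subseteq> U
    \<and> (\<forall>y\<in>V. d a y > ennreal \<epsilon>))"
  have step: "\<exists>q. good q \<and> fst q \<in> W \<and> snd q \<subseteq> W"
    if W: "openin T W" "x \<in> W" "W \<subseteq> U" for W
  proof -
    have sub: "W \<subseteq> topspace T" using W(1) by (rule openin_subset)
    obtain a where a: "a \<in> W" "d a x > ennreal \<epsilon>"
      using far_point_of_large_diam[OF sub _ \<open>0 \<le> \<epsilon>\<close> large[OF W(1,2)], of x] W sub by blast
    define V where "V = W \<inter> {y \<in> topspace T. d a y > ennreal \<epsilon>}"
    have "openin T V"
      unfolding V_def using W(1) a sub \<open>0 \<le> \<epsilon>\<close> by (intro openin_Int openin_far) auto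
    then have "good (a, V)"
      using a W sub by (auto simp: good_def V_def)
    then show ?thesis
      using a by (intro exI[of _ "(a, V)"]) (auto simp: V_def)
  qed
  have "\<exists>s. \<forall>n. good (s n) \<and> fst (s (Suc n)) \<in> snd (s n) \<and> snd (s (Suc n)) \<subseteq> snd (s n)"
  proof (rule dependent_nat_choice)
    show "\<exists>q. good q" using step[OF U(1) x] by blast
  next
    fix p :: "'a \<times> 'a set" and n :: nat
    assume "good p"
    then show "\<exists>q. good q \<and> fst q \<in> snd p \<and> snd q \<subseteq> snd p"
      using step[of "snd p"] by (auto simp: good_def split: prod.splits)
  qed
  then obtain s where s: "\<And>n. good (s n)"
    and pt: "\<And>n. fst (s (Suc n)) \<in> snd (s n)" and nested: "\<And>n. snd (s (Suc n)) \<subseteq> snd (s n)"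
    by blast
  have far: "d (fst (s n)) y > ennreal \<epsilon>" if "y \<in> snd (s n)" for n y
    using s[of n] that by (auto simp: good_def split: prod.splits)
  have in_U: "fst (s n) \<in> U" and x_nhd: "x \<in> snd (s n)" for n
    using s[of n] by (auto simp: good_def split: prod.splits)
  have sep: "d (fst (s m)) (fst (s n)) > ennreal \<epsilon>" if mn: "m < n" for m n
  proof (rule far)
    obtain k where k: "n = Suc k" "m \<le> k" using mn by (cases n) auto
    have "snd (s k) \<subseteq> snd (s m)" using nested k(2) by (rule lift_Suc_antimono_le)
    then show "fst (s n) \<in> snd (s m)" using pt[of k] k(1) by blast
  qed
  define a where "a = (\<lambda>i. case i of enat n \<Rightarrow> fst (s n) | \<infinity> \<Rightarrow> x)"
  have "a i \<in> U" for i using in_U x by (simp add: a_def split: enat.split)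
  moreover have "d (a i) (a j) > ennreal \<epsilon>" if "i < j" for i j
    using that sep far[OF x_nhd] by (auto simp: a_def split: enat.splits)
  ultimately show False using U(2) unfolding eps_bounded_def eps_alpha_finite_def by blast
qed

end

lemma diam_imp_eps_finite:
  assumes "diam d U \<le> ennreal \<epsilon>"
  shows "eps_finite d \<epsilon> U"
  unfolding eps_finite_def eps_alpha_finite_def
proof (intro exI[of _ 1] notI, elim exE conjE)
  fix a :: "enat \<Rightarrow> 'a"
  assume a: "\<forall>i\<le>enat 1. a i \<in> U"
    and sep: "\<forall>i j. i < j \<and> j \<le> enat 1 \<longrightarrow> d (a i) (a j) > ennreal \<epsilon>"
  have "a (enat 0) \<in> U" "a (enat 1) \<in> U" using a by auto
  then have "d (a (enat 0)) (a (enat 1)) \<le> diam d U"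
    unfolding diam_def by (meson SUP_upper2 order_refl)
  moreover have "d (a (enat 0)) (a (enat 1)) > ennreal \<epsilon>"
    using sep[rule_format, of "enat 0" "enat 1"] by simp
  ultimately show False using assms by (meson leD order_trans)
qed

lemma eps_finite_imp_bounded: "eps_finite d \<epsilon> U \<Longrightarrow> eps_bounded d \<epsilon> U"
  unfolding eps_finite_def eps_bounded_def eps_alpha_finite_def
  by (metis enat_ord_simps(3))

lemma cb_derivative_subset:
  assumes "\<And>U x. openin T U \<Longrightarrow> cb_small k' d \<epsilon>' U \<Longrightarrow> x \<in> U
    \<Longrightarrow> \<exists>V. openin T V \<and> cb_small k d \<epsilon> V \<and> x \<in> V"
  shows "cb_derivative k T d \<epsilon> \<subseteq> cb_derivative k' T d \<epsilon>'"
  unfolding cb_derivative_def using assms by blast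

text \<open>The comparison of derivatives is needed on all subspaces, since the two iterations pass
  through different ones; monotonicity of the derivative in the space bridges the gap.\<close>

lemma cb_iter_subset:
  fixes \<alpha> :: "'o::wellorder"
  assumes step: "\<And>S. cb_derivative k (subtopology T S) d \<epsilon>
    \<subseteq> cb_derivative k' (subtopology T S) d \<epsilon>'"
  shows "cb_iter k T d \<epsilon> \<alpha> \<subseteq> cb_iter k' T d \<epsilon>' \<alpha>"
proof (induction \<alpha> rule: less_induct)
  case (less \<alpha>)
  show ?case
  proof (cases \<alpha> rule: cb_iter_cases)
    case zero
    then show ?thesis by (simp add: cb_iter_zero)
  next
    case (succ \<beta>)
    have "cb_iter k T d \<epsilon> \<alpha> = cb_derivative k (subtopology T (cb_iter k T d \<epsilon> \<beta>)) d \<epsilon>"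
      using succ by (rule cb_iter_succ)
    also have "\<dots> \<subseteq> cb_derivative k (subtopology T (cb_iter k' T d \<epsilon>' \<beta>)) d \<epsilon>"
      using less.IH[OF succ(1)] by (rule cb_derivative_mono)
    also have "\<dots> \<subseteq> cb_derivative k' (subtopology T (cb_iter k' T d \<epsilon>' \<beta>)) d \<epsilon>'"
      by (rule step)
    also have "\<dots> = cb_iter k' T d \<epsilon>' \<alpha>"
      using succ by (rule cb_iter_succ[symmetric])
    finally show ?thesis .
  next
    case (limit \<beta>)
    have "cb_iter k T d \<epsilon> \<alpha> = (\<Inter>\<beta>\<in>{..<\<alpha>}. cb_iter k T d \<epsilon> \<beta>)"
      using limit by (rule cb_iter_limit)
    also have "\<dots> \<subseteq> (\<Inter>\<beta>\<in>{..<\<alpha>}. cb_iter k' T d \<epsilon>' \<beta>)"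
      using less.IH by (intro INF_mono) auto
    also have "\<dots> = cb_iter k' T d \<epsilon>' \<alpha>"
      using limit by (rule cb_iter_limit[symmetric])
    finally show ?thesis .
  qed
qed

lemma cb_iter_d_subset_b:
  fixes \<alpha> :: "'o::wellorder"
  assumes "topometric_space T d" "0 \<le> \<epsilon>"
  shows "cb_iter CB_d T d (2 * \<epsilon>) \<alpha> \<subseteq> cb_iter CB_b T d \<epsilon> \<alpha>"
proof (rule cb_iter_subset, rule cb_derivative_subset)
  fix S U x
  assume "openin (subtopology T S) U" "cb_small CB_b d \<epsilon> U" "x \<in> U"
  then obtain V where "openin (subtopology T S) V" "x \<in> V" "diam d V \<le> ennreal (2 * \<epsilon>)"
    using topometric_space.diam_nhd_in_bounded_open
      [OF topometric_subspace[OF assms(1)], of S U \<epsilon> x] assms(2)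
    by auto
  then show "\<exists>V. openin (subtopology T S) V \<and> cb_small CB_d d (2 * \<epsilon>) V \<and> x \<in> V"
    by auto
qed

lemma cb_iter_b_subset_f:
  fixes \<alpha> :: "'o::wellorder"
  shows "cb_iter CB_b T d \<epsilon> \<alpha> \<subseteq> cb_iter CB_f T d \<epsilon> \<alpha>"
  by (intro cb_iter_subset cb_derivative_subset) (auto intro: eps_finite_imp_bounded)

lemma cb_iter_f_subset_d:
  fixes \<alpha> :: "'o::wellorder"
  shows "cb_iter CB_f T d \<epsilon> \<alpha> \<subseteq> cb_iter CB_d T d \<epsilon> \<alpha>"
  by (intro cb_iter_subset cb_derivative_subset) (auto intro: diam_imp_eps_finite)

text \<open>When some ordinal is missed by \<open>A\<close> on the larger side, it bounds all ordinals whose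
  iterate meets \<open>A\<close>, because the iteration decreases. So the least upper bound on that side
  exists, and it is an upper bound on the smaller side too.\<close>

lemma cb_rank_mono:
  assumes sub: "\<And>\<alpha> :: 'a ordinal. cb_iter k T d \<epsilon> \<alpha> \<subseteq> cb_iter k' T d \<epsilon>' \<alpha>"
  shows "cb_rank k T d \<epsilon> A \<le> cb_rank k' T d \<epsilon>' (A :: 'a set)"
proof (cases "\<forall>\<alpha> :: 'a ordinal. cb_iter k' T d \<epsilon>' \<alpha> \<inter> A \<noteq> {}")
  case True
  then have "cb_rank k' T d \<epsilon>' A = Pinf" unfolding cb_rank_def by (rule if_P)
  then show ?thesis by simp
next
  case False
  then obtain \<delta> :: "'a ordinal" where \<delta>: "cb_iter k' T d \<epsilon>' \<delta> \<inter> A = {}" by blast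
  define bound' where
    "bound' = (\<lambda>\<beta> :: 'a ordinal. \<forall>\<alpha>. cb_iter k' T d \<epsilon>' \<alpha> \<inter> A \<noteq> {} \<longrightarrow> \<alpha> \<le> \<beta>)"
  define bound where
    "bound = (\<lambda>\<beta> :: 'a ordinal. \<forall>\<alpha>. cb_iter k T d \<epsilon> \<alpha> \<inter> A \<noteq> {} \<longrightarrow> \<alpha> \<le> \<beta>)"
  have "bound' \<delta>"
    unfolding bound'_def
  proof (intro allI impI)
    fix \<alpha> :: "'a ordinal" assume "cb_iter k' T d \<epsilon>' \<alpha> \<inter> A \<noteq> {}"
    then have "\<not> \<delta> \<le> \<alpha>" using cb_iter_antimono[of \<delta> \<alpha> k' T d \<epsilon>'] \<delta> by blast
    then show "\<alpha> \<le> \<delta>" by simp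
  qed
  then have "bound' (LEAST \<beta>. bound' \<beta>)" by (rule LeastI)
  then have "bound (LEAST \<beta>. bound' \<beta>)"
    unfolding bound_def bound'_def using sub by blast
  then have "(LEAST \<beta>. bound \<beta>) \<le> (LEAST \<beta>. bound' \<beta>)" by (rule Least_le)
  moreover have "cb_rank k' T d \<epsilon>' A = Fin (LEAST \<beta>. bound' \<beta>)"
    unfolding cb_rank_def bound'_def using False by (rule if_not_P)
  moreover have "\<not> (\<forall>\<alpha> :: 'a ordinal. cb_iter k T d \<epsilon> \<alpha> \<inter> A \<noteq> {})"
    using \<delta> sub by blast
  then have "cb_rank k T d \<epsilon> A = Fin (LEAST \<beta>. bound \<beta>)"
    unfolding cb_rank_def bound_def by (rule if_not_P)
  ultimately show ?thesis by simp
qed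

lemma eps_cb_analysable_antimono:
  assumes "\<And>\<alpha> :: 'a ordinal. cb_iter k T d \<epsilon> \<alpha> \<subseteq> (cb_iter k' T d \<epsilon>' \<alpha> :: 'a set)"
    and "eps_cb_analysable k' T d \<epsilon>'"
  shows "eps_cb_analysable k T d \<epsilon>"
  using assms unfolding eps_cb_analysable_def cb_infinity_def by blast

theorem proposition3p6:
  fixes T :: "'a topology" and d :: "'a \<Rightarrow> 'a \<Rightarrow> ennreal"
  assumes "topometric_space T d"
  shows "(\<forall>(\<alpha> :: 'o::wellorder) \<epsilon>::real. \<epsilon> > 0 \<longrightarrow>
            cb_iter CB_d T d (2 * \<epsilon>) \<alpha> \<subseteq> cb_iter CB_b T d \<epsilon> \<alpha> \<and>
            cb_iter CB_b T d \<epsilon> \<alpha> \<subseteq> cb_iter CB_f T d \<epsilon> \<alpha> \<and>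
            cb_iter CB_f T d \<epsilon> \<alpha> \<subseteq> cb_iter CB_d T d \<epsilon> \<alpha>)
       \<and> (\<forall>A \<epsilon>::real. A \<subseteq> topspace T \<longrightarrow> \<epsilon> > 0 \<longrightarrow>
            cb_rank CB_d T d (2 * \<epsilon>) A \<le> cb_rank CB_b T d \<epsilon> A \<and>
            cb_rank CB_b T d \<epsilon> A \<le> cb_rank CB_f T d \<epsilon> A \<and>
            cb_rank CB_f T d \<epsilon> A \<le> cb_rank CB_d T d \<epsilon> A)
       \<and> (\<forall>k k'. cb_analysable k T d \<longleftrightarrow> cb_analysable k' T d)"
proof -
  note d_b = cb_iter_d_subset_b[OF assms less_imp_le]
  have db: "cb_analysable CB_d T d" if "cb_analysable CB_b T d"
    unfolding cb_analysable_def
  proof (intro allI impI)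
    fix \<epsilon> :: real assume "\<epsilon> > 0"
    then have "eps_cb_analysable CB_b T d (\<epsilon> / 2)"
      using \<open>cb_analysable CB_b T d\<close> by (simp add: cb_analysable_def)
    then have "eps_cb_analysable CB_d T d (2 * (\<epsilon> / 2))"
      using \<open>\<epsilon> > 0\<close> by (intro eps_cb_analysable_antimono[OF d_b]) auto
    then show "eps_cb_analysable CB_d T d \<epsilon>" by simp
  qed
  have bf: "cb_analysable CB_b T d" if "cb_analysable CB_f T d"
    using that eps_cb_analysable_antimono[OF cb_iter_b_subset_f] unfolding cb_analysable_def by blast
  have fd: "cb_analysable CB_f T d" if "cb_analysable CB_d T d"
    using that eps_cb_analysable_antimono[OF cb_iter_f_subset_d] unfolding cb_analysable_def by blast
  have analysable_d: "cb_analysable k T d \<longleftrightarrow> cb_analysable CB_d T d" for k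
    using db bf fd by (cases k) auto
  have "cb_analysable k T d \<longleftrightarrow> cb_analysable k' T d" for k k'
    using analysable_d[of k] analysable_d[of k'] by simp
  then show ?thesis
    by (intro conjI allI impI d_b cb_iter_b_subset_f cb_iter_f_subset_d cb_rank_mono)
qed

end
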